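(* Let $m\ge1$. Suppose that $f_\Sigma(x)$ (for $\Sigma\in\mathbb{Z}_{\ge0}^m\setminus\{0\}$), $g^{(d)}_\Sigma(x)$ (for $\Sigma\in\mathbb{Z}_{\ge0}^m$ and integers $d\ge1$) and $\psi_n(x)$ (for integers $n\ge1$) satisfy the following conditions: (1) $f_\Sigma(x)\in\mathbb{Q}[x]$ for all $\Sigma$. (2) $g^{(d)}_\Sigma(x)\in\mathcal{L}[x]$ for all $d$ and $\Sigma$. For a partition $\lambda=(\lambda_1,\dots,\lambda_{l(\lambda)})$ define $$g^{(\lambda)}_\Sigma(x)=\sum_{\Sigma_1+\cdots+\Sigma_{l(\lambda)}=\Sigma}g^{(\lambda_1)}_{\Sigma_1}(x)\cdots g^{(\lambda_{l(\lambda)})}_{\Sigma_{l(\lambda)}}(x),$$ where the sum is over ordered tuples of elements of $\mathbb{Z}_{\ge0}^m$. (3) Each $\psi_k(x)\in\mathbb{Z}[x]$ is monic of degree $k$, and $\psi_{np}(x)-\psi_n(x)^p\equiv0 \pmod p$ (coefficientwise) for every prime $p$ and every $n\ge1$. (4) For every $\Sigma\in\mathbb{Z}_{\ge0}^m\setminus\{0\}$, $$f_\Sigma(x)=x\cdot\sum_{n\mid\Sigma}\frac{\mu(n)}{n}\sum_{\lambda\vdash|\Sigma|/n}\theta_\lambda\,g^{(\lambda)}_{\Sigma/n}(\psi_n(x)).$$ Then $f_\Sigma(x)\in\mathbb{Z}[x]$ for every $\Sigma\in\mathbb{Z}_{\ge0}^m\setminus\{0\}$.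
   Context: $\mathcal{L}[x]=\{a(x)/b(x): a(x),b(x)\in\mathbb{Z}[x],\ b(x)\ne0 \text{ monic}\}\subset\mathbb{Q}(x)$. For $\Sigma=(k_1,\dots,k_m)\in\mathbb{Z}_{\ge0}^m$, $|\Sigma|=\sum_i k_i$. Moreover $n\mid\Sigma$ means that the positive integer $n$ divides every $k_i$, and $\Sigma/n=(k_1/n,\dots,k_m/n)$. $\mu$ is the Möbius function. $\lambda\vdash d$ means that $\lambda$ is a partition of $d$, $l(\lambda)$ is its number of nonzero parts, and $m_i(\lambda)$ is the number of parts equal to $i$. Finally $$\theta_\lambda=\frac{(-1)^{l(\lambda)-1}(l(\lambda)-1)!}{\prod_{i\ge1}m_i(\lambda)!}.$$ *)

theory Defs
  imports
    "HOL-Analysis.Finite_Cartesian_Product"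
    "HOL-Computational_Algebra.Computational_Algebra"
    "HOL-Number_Theory.Cong"
begin

text \<open>
  The field \<open>\<rat>(x)\<close> is \<^typ>\<open>rat poly fract\<close>; it contains \<open>\<rat>[x]\<close> via \<^const>\<open>to_fract\<close>.
  A multi-index in \<open>\<int>\<^sub>\<ge>\<^sub>0\<^sup>m\<close> is an element of \<^typ>\<open>nat ^ 'm\<close>, where \<open>m = CARD('m) \<ge> 1\<close>.
\<close>

definition rat_of_int_poly :: "int poly \<Rightarrow> rat poly" where
  "rat_of_int_poly p = map_poly of_int p"

definition rat_polys :: "rat poly fract set" where
  "rat_polys = range to_fract"

definition int_polys :: "rat poly fract set" where
  "int_polys = range (\<lambda>p. to_fract (rat_of_int_poly p))"

definition L_ring :: "rat poly fract set" where
  "L_ring = {Fract (rat_of_int_poly a) (rat_of_int_poly b) | a b. b \<noteq> 0 \<and> lead_coeff b = 1}"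

definition const_fract :: "rat \<Rightarrow> rat poly fract" where
  "const_fract c = to_fract [:c:]"

definition X_fract :: "rat poly fract" where
  "X_fract = to_fract [:0, 1:]"

text \<open>
  The substitution \<open>h(x) \<mapsto> h(p(x))\<close>. It is meaningful for nonconstant \<open>p\<close>, where the right-hand
  side does not depend on the fraction representing \<open>h\<close> (see \<open>subst_fract_Fract\<close>).
\<close>

definition subst_fract :: "rat poly fract \<Rightarrow> rat poly \<Rightarrow> rat poly fract" where
  "subst_fract h p =
     (THE r. \<exists>a b. b \<noteq> 0 \<and> h = Fract a b \<and> r = Fract (pcompose a p) (pcompose b p))"

lemma subst_fract_Fract:
  assumes "degree p > 0" and "b \<noteq> 0"
  shows "subst_fract (Fract a b) p = Fract (pcompose a p) (pcompose b p)"
  unfolding subst_fract_def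
proof (rule the_equality)
  show "\<exists>a' b'. b' \<noteq> 0 \<and> Fract a b = Fract a' b' \<and>
          Fract (pcompose a p) (pcompose b p) = Fract (pcompose a' p) (pcompose b' p)"
    using assms by blast
next
  fix r
  assume "\<exists>c d. d \<noteq> 0 \<and> Fract a b = Fract c d \<and> r = Fract (pcompose c p) (pcompose d p)"
  then obtain c d where d: "d \<noteq> 0" "Fract a b = Fract c d"
    and r: "r = Fract (pcompose c p) (pcompose d p)"
    by blast
  have "c * b = a * d"
    using d assms by (simp add: eq_fract)
  then have "pcompose c p * pcompose b p = pcompose a p * pcompose d p"
    by (metis pcompose_mult)
  moreover have "pcompose b p \<noteq> 0" "pcompose d p \<noteq> 0"
    using assms d pcompose_eq_0 by blast+
  ultimately show "r = Fract (pcompose a p) (pcompose b p)"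
    by (simp add: r eq_fract)
qed

definition moebius :: "nat \<Rightarrow> int" where
  "moebius n = (if squarefree n then (-1) ^ card (prime_factors n) else 0)"

definition mi_size :: "nat ^ 'm::finite \<Rightarrow> nat" where
  "mi_size S = (\<Sum>i\<in>UNIV. S $ i)"

definition mi_dvd :: "nat \<Rightarrow> nat ^ 'm::finite \<Rightarrow> bool" where
  "mi_dvd n S \<longleftrightarrow> n \<ge> 1 \<and> (\<forall>i. n dvd S $ i)"

definition mi_div :: "nat ^ 'm::finite \<Rightarrow> nat \<Rightarrow> nat ^ 'm" where
  "mi_div S n = (\<chi> i. S $ i div n)"

text \<open>A partition is the weakly decreasing list of its nonzero parts.\<close>

definition partitions :: "nat \<Rightarrow> nat list set" where
  "partitions d = {l. sorted_wrt (\<ge>) l \<and> (\<forall>k\<in>set l. k \<ge> 1) \<and> sum_list l = d}"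

definition theta :: "nat list \<Rightarrow> rat" where
  "theta l = (-1) ^ (length l - 1) * fact (length l - 1) /
     (\<Prod>i\<in>set l. fact (count_list l i))"

definition tuples :: "nat \<Rightarrow> nat ^ 'm::finite \<Rightarrow> (nat ^ 'm) list set" where
  "tuples r S = {Ss. length Ss = r \<and> sum_list Ss = S}"

definition g_part ::
  "(nat \<Rightarrow> nat ^ 'm::finite \<Rightarrow> rat poly fract) \<Rightarrow> nat list \<Rightarrow> nat ^ 'm \<Rightarrow> rat poly fract" where
  "g_part g l S = (\<Sum>Ss\<in>tuples (length l) S. \<Prod>j<length l. g (l ! j) (Ss ! j))"

text \<open>The index sets of all the sums involved are finite.\<close>

lemma finite_mi_dvd:
  assumes "S \<noteq> 0"
  shows "finite {n. mi_dvd n S}"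
proof -
  obtain i where "S $ i \<noteq> 0"
    using assms by (auto simp: vec_eq_iff)
  then have "{n. mi_dvd n S} \<subseteq> {..S $ i}"
    by (auto simp: mi_dvd_def dvd_imp_le)
  then show ?thesis
    using finite_subset by blast
qed

lemma finite_partitions: "finite (partitions d)"
proof -
  have "partitions d \<subseteq> {l. set l \<subseteq> {..d} \<and> length l \<le> d}"
  proof
    fix l assume "l \<in> partitions d"
    then have l: "\<forall>k\<in>set l. k \<ge> 1" "sum_list l = d"
      by (auto simp: partitions_def)
    have "length l \<le> sum_list l"
      using l(1) by (induction l) auto
    then show "l \<in> {l. set l \<subseteq> {..d} \<and> length l \<le> d}"
      using l member_le_sum_list by fastforce
  qed
  then show ?thesis
    using finite_lists_length_le[of "{..d}" d] finite_subset by blast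
qed

lemma finite_tuples: "finite (tuples r (S :: nat ^ 'm::finite))"
proof -
  let ?B = "{v :: nat ^ 'm. \<forall>i. v $ i \<le> S $ i}"
  have "finite ?B"
  proof (rule finite_subset)
    show "?B \<subseteq> vec_lambda ` (Pi\<^sub>E UNIV (\<lambda>i. {..S $ i}))"
    proof
      fix v assume "v \<in> ?B"
      then have "v = vec_lambda (($) v)" "($) v \<in> Pi\<^sub>E UNIV (\<lambda>i. {..S $ i})"
        by auto
      then show "v \<in> vec_lambda ` (Pi\<^sub>E UNIV (\<lambda>i. {..S $ i}))"
        by blast
    qed
    show "finite (vec_lambda ` (Pi\<^sub>E UNIV (\<lambda>i. {..S $ i})) :: (nat ^ 'm) set)"
      by (intro finite_imageI finite_PiE) auto
  qed
  moreover have "v $ i \<le> sum_list Ss $ i" if "v \<in> set Ss" for v i and Ss :: "(nat ^ 'm) list"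
    using that by (induction Ss) (auto intro: le_add1 trans_le_add2)
  then have "tuples r S \<subseteq> {Ss. set Ss \<subseteq> ?B \<and> length Ss = r}"
    by (auto simp: tuples_def)
  ultimately show ?thesis
    using finite_lists_length_eq[of ?B r] finite_subset by blast
qed

end

theory Submission
  imports Defs "HOL-Library.Poly_Mapping" "HOL-Library.Product_Plus"
    "HOL-Combinatorics.Multiset_Permutations"
begin

text \<open>
  Since \<open>\<theta>\<^sub>\<lambda>\<close> is \<open>(-1)\<^bsup>l-1\<^esup>/l\<close> times the number of orderings of \<open>\<lambda>\<close>, the inner sum at level \<open>n\<close> is a
  coefficient of \<open>log (1 - A)\<close>, where \<open>-A\<close> is the generating series of the \<open>g\<^sup>d\<^sub>U(\<psi>\<^sub>n(x))\<close> with
  \<open>d \<ge> 1\<close>; only finitely many letters \<open>(d, U)\<close> matter, so \<open>A\<close> may be taken to be a polynomial.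
  For a prime \<open>p\<close>, pair the terms \<open>n\<close> and \<open>pn\<close> with \<open>\<not> p dvd n\<close>. If \<open>A'\<close> arises from \<open>A\<close> by replacing
  \<open>\<psi>\<^sub>n\<close> by \<open>\<psi>\<^sub>p\<^sub>n\<close> and multiplying all exponents by \<open>p\<close>, then \<open>A\<^sup>p \<equiv> A'\<close> modulo \<open>p\<close> by the Frobenius
  congruence and the hypothesis on \<open>\<psi>\<close>. Hence \<open>A\<^sup>k \<equiv> A'\<^bsup>k/p\<^esup>\<close> modulo the \<open>p\<close>-part of \<open>k\<close>, and
  \<open>log (1 - A) - log (1 - A') / p\<close> is \<open>p\<close>-integral. So for every \<open>p\<close> some multiple of \<open>f\<^sub>\<Sigma>\<close> by an
  integer prime to \<open>p\<close> has a monic integral denominator; division with remainder by monic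
  polynomials then shows that \<open>f\<^sub>\<Sigma>\<close> is integral.
\<close>

unbundle no fps_syntax

section \<open>Congruences relative to a subring\<close>

locale subring_set =
  fixes R :: "'a::comm_ring_1 set"
  assumes zero_closed: "0 \<in> R"
    and one_closed: "1 \<in> R"
    and add_closed: "a \<in> R \<Longrightarrow> b \<in> R \<Longrightarrow> a + b \<in> R"
    and uminus_closed: "a \<in> R \<Longrightarrow> - a \<in> R"
    and mult_closed: "a \<in> R \<Longrightarrow> b \<in> R \<Longrightarrow> a * b \<in> R"
begin

lemma power_closed: "a \<in> R \<Longrightarrow> a ^ n \<in> R"
  by (induction n) (auto intro: one_closed mult_closed)

lemma of_nat_closed: "of_nat n \<in> R"
  by (induction n) (auto intro: zero_closed one_closed add_closed)

lemma of_int_closed: "of_int n \<in> R"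
  by (cases n) (auto intro: of_nat_closed uminus_closed simp del: of_nat_Suc)

lemma sum_closed: "(\<And>i. i \<in> I \<Longrightarrow> h i \<in> R) \<Longrightarrow> sum h I \<in> R"
  by (induction I rule: infinite_finite_induct) (auto intro: zero_closed add_closed)

lemma prod_list_closed: "(\<And>x. x \<in> set xs \<Longrightarrow> x \<in> R) \<Longrightarrow> prod_list xs \<in> R"
  by (induction xs) (auto intro: one_closed mult_closed)

definition cong_in :: "nat \<Rightarrow> 'a \<Rightarrow> 'a \<Rightarrow> bool" where
  "cong_in m a b \<longleftrightarrow> (\<exists>c\<in>R. a - b = of_nat m * c)"

lemma cong_in_refl: "cong_in m a a"
  unfolding cong_in_def by (rule bexI[of _ 0]) (auto intro: zero_closed)

lemma cong_in_trans: "cong_in m a b \<Longrightarrow> cong_in m b c \<Longrightarrow> cong_in m a c"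
  unfolding cong_in_def
proof safe
  fix d e assume "d \<in> R" "a - b = of_nat m * d" "e \<in> R" "b - c = of_nat m * e"
  then show "\<exists>x\<in>R. a - c = of_nat m * x"
    by (intro bexI[of _ "d + e"]) (auto intro: add_closed simp: algebra_simps)
qed

lemma cong_in_add:
  assumes "cong_in m a b" "cong_in m c d"
  shows "cong_in m (a + c) (b + d)"
proof -
  obtain x y where "x \<in> R" "y \<in> R" "a - b = of_nat m * x" "c - d = of_nat m * y"
    using assms by (auto simp: cong_in_def)
  then show ?thesis
    unfolding cong_in_def by (intro bexI[of _ "x + y"]) (auto intro: add_closed simp: algebra_simps)
qed

lemma cong_in_mult_left:
  assumes "cong_in m a b" "c \<in> R"
  shows "cong_in m (c * a) (c * b)"
proof -
  obtain x where "x \<in> R" "a - b = of_nat m * x"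
    using assms by (auto simp: cong_in_def)
  then show ?thesis
    unfolding cong_in_def using assms(2)
    by (intro bexI[of _ "c * x"]) (auto intro: mult_closed simp: algebra_simps simp flip: right_diff_distrib)
qed

lemma cong_in_mult:
  assumes "cong_in m a b" "cong_in m c d" "a \<in> R" "d \<in> R"
  shows "cong_in m (a * c) (b * d)"
  using cong_in_trans[OF cong_in_mult_left[of m c d a] cong_in_mult_left[of m a b d, unfolded mult.commute[of d]]]
    assms by blast

lemma cong_in_sum: "(\<And>i. i \<in> I \<Longrightarrow> cong_in m (h i) (k i)) \<Longrightarrow> cong_in m (sum h I) (sum k I)"
  by (induction I rule: infinite_finite_induct) (auto intro: cong_in_refl cong_in_add)

lemma cong_in_power:
  assumes "cong_in m a b" "a \<in> R" "b \<in> R"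
  shows "cong_in m (a ^ n) (b ^ n)"
  by (induction n) (auto intro: cong_in_refl cong_in_mult assms power_closed)

lemma cong_in_frobenius:
  assumes "prime p" "a \<in> R" "b \<in> R"
  shows "cong_in p ((a + b) ^ p) (a ^ p + b ^ p)"
proof -
  let ?k = "\<lambda>i. if i = 0 then b ^ p else if i = p then a ^ p else 0"
  have p: "p > 0" using assms(1) by (rule prime_gt_0_nat)
  have "cong_in p (\<Sum>i\<le>p. of_nat (p choose i) * a ^ i * b ^ (p - i)) (\<Sum>i\<le>p. ?k i)"
  proof (rule cong_in_sum)
    fix i assume "i \<in> {..p}"
    then consider "i = 0" | "i = p" "i \<noteq> 0" | "0 < i" "i < p" by fastforce
    then show "cong_in p (of_nat (p choose i) * a ^ i * b ^ (p - i)) (?k i)"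
    proof cases
      case 3
      then have "p dvd p choose i"
        using assms(1) by (simp add: dvd_choose_prime)
      then obtain q where "p choose i = p * q" ..
      then show ?thesis
        unfolding cong_in_def using 3 assms
        by (intro bexI[of _ "of_nat q * a ^ i * b ^ (p - i)"])
          (auto intro!: mult_closed of_nat_closed power_closed simp: mult.assoc)
    qed (auto intro: cong_in_refl)
  qed
  moreover have "(\<Sum>i\<le>p. ?k i) = a ^ p + b ^ p"
  proof -
    have "(\<Sum>i\<le>p. ?k i) = (\<Sum>i\<le>p. (if i = p then a ^ p else 0) + (if i = 0 then b ^ p else 0))"
      using p by (intro sum.cong) auto
    then show ?thesis by (simp add: sum.distrib)
  qed
  ultimately show ?thesis by (simp add: binomial_ring)
qed

lemma cong_in_frobenius_sum:
  assumes "prime p" "\<And>i. i \<in> I \<Longrightarrow> h i \<in> R"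
  shows "cong_in p ((\<Sum>i\<in>I. h i) ^ p) (\<Sum>i\<in>I. h i ^ p)"
  using assms(2)
proof (induction I rule: infinite_finite_induct)
  case (insert x F)
  have "cong_in p ((h x + sum h F) ^ p) (h x ^ p + sum h F ^ p)"
    using insert by (intro cong_in_frobenius assms(1) sum_closed) auto
  also have "cong_in p (h x ^ p + sum h F ^ p) (h x ^ p + (\<Sum>i\<in>F. h i ^ p))"
    using insert by (intro cong_in_add cong_in_refl) auto
  finally (cong_in_trans) show ?case using insert by simp
qed (use assms(1) in \<open>auto intro: cong_in_refl simp: power_0_left\<close>)

lemma cong_in_fermat:
  assumes "prime p"
  shows "cong_in p (of_int c ^ p) (of_int c)"
proof -
  have nat: "cong_in p (of_nat n ^ p) (of_nat n)" for n
  proof (induction n)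
    case (Suc n)
    have "cong_in p ((of_nat n + 1) ^ p) (of_nat n ^ p + 1 ^ p)"
      by (intro cong_in_frobenius assms of_nat_closed one_closed)
    also have "cong_in p (of_nat n ^ p + 1 ^ p) (of_nat n + 1)"
      using Suc by (intro cong_in_add) (auto intro: cong_in_refl)
    finally (cong_in_trans) show ?case by (simp add: add.commute)
  qed (use prime_gt_0_nat[OF assms] in \<open>auto intro: cong_in_refl simp: power_0_left\<close>)
  define n where "n = nat (c mod p)"
  have "c = int p * (c div int p) + int n"
    using prime_gt_0_nat[OF assms] by (simp add: n_def)
  then have c: "(of_int c :: 'a) = of_nat p * of_int (c div int p) + of_nat n"
    by (metis of_int_add of_int_mult of_int_of_nat_eq)
  then have 1: "cong_in p (of_int c) (of_nat n)"
    unfolding cong_in_def by (intro bexI[of _ "of_int (c div int p)"] of_int_closed) (simp only: diff_eq_eq)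
  from c have 2: "cong_in p (of_nat n) (of_int c)"
    unfolding cong_in_def by (intro bexI[of _ "- of_int (c div int p)"]) (auto intro: of_int_closed uminus_closed)
  show ?thesis
    using cong_in_trans[OF cong_in_trans[OF cong_in_power[OF 1 of_int_closed of_nat_closed] nat] 2] .
qed

lemma cong_in_lift:
  assumes "cong_in m a b" "a \<in> R" "b \<in> R" "p dvd m"
  shows "cong_in (m * p) (a ^ p) (b ^ p)"
proof -
  obtain c where c: "c \<in> R" "a - b = of_nat m * c"
    using assms(1) by (auto simp: cong_in_def)
  obtain q where q: "m = p * q" using assms(4) ..
  have "cong_in m (\<Sum>i<p. b ^ (p - Suc i) * a ^ i) (\<Sum>i<p. b ^ (p - Suc i) * b ^ i)"
    by (intro cong_in_sum cong_in_mult_left cong_in_power assms power_closed)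
  also have "(\<Sum>i<p. b ^ (p - Suc i) * b ^ i) = of_nat p * b ^ (p - 1)"
    by (simp flip: power_add)
  finally obtain d where d: "d \<in> R" "(\<Sum>i<p. b ^ (p - Suc i) * a ^ i) - of_nat p * b ^ (p - 1) = of_nat m * d"
    unfolding cong_in_def by blast
  have "a ^ p - b ^ p = (a - b) * (\<Sum>i<p. b ^ (p - Suc i) * a ^ i)"
    by (rule power_diff_sumr2)
  also have "(\<Sum>i<p. b ^ (p - Suc i) * a ^ i) = of_nat p * (b ^ (p - 1) + of_nat q * d)"
    using d(2) by (simp add: q algebra_simps)
  finally have "a ^ p - b ^ p = of_nat (m * p) * (c * (b ^ (p - 1) + of_nat q * d))"
    using c by (simp add: mult_ac)
  then show ?thesis
    unfolding cong_in_def using c d assms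
    by (intro bexI[of _ "c * (b ^ (p - 1) + of_nat q * d)"])
      (auto intro!: mult_closed add_closed power_closed of_nat_closed)
qed

lemma cong_in_prime_power:
  assumes "cong_in p a b" "a \<in> R" "b \<in> R"
  shows "cong_in (p ^ Suc k) (a ^ (p ^ k)) (b ^ (p ^ k))"
proof (induction k)
  case (Suc k)
  then have "cong_in (p ^ Suc k * p) ((a ^ (p ^ k)) ^ p) ((b ^ (p ^ k)) ^ p)"
    by (rule cong_in_lift) (auto intro: power_closed assms)
  then show ?case by (simp add: mult_ac flip: power_mult)
qed (use assms in simp)

end

lemma subring_set_poly_mapping:
  fixes R :: "'a::comm_ring_1 set"
  assumes "subring_set R"
  shows "subring_set {P :: 'b::cancel_comm_monoid_add \<Rightarrow>\<^sub>0 'a. \<forall>v. Poly_Mapping.lookup P v \<in> R}"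
proof -
  interpret subring_set R by fact
  have Sum_any_closed: "Sum_any h \<in> R" if "\<And>x. h x \<in> R" for h :: "'b \<Rightarrow> 'a"
    using that by (auto simp: Sum_any.expand_set intro: sum_closed)
  show ?thesis
    by standard
      (auto simp: lookup_one lookup_add lookup_mult when_def
        intro!: Sum_any_closed mult_closed intro: zero_closed one_closed add_closed uminus_closed)
qed


lemma prod_list_sum_single:
  fixes h :: "'c \<Rightarrow> 'd \<Rightarrow> 'a::comm_semiring_1" and e :: "'d \<Rightarrow> 'b::cancel_comm_monoid_add"
  assumes "finite I"
  shows "prod_list (map (\<lambda>j. \<Sum>v\<in>I. Poly_Mapping.single (e v) (h j v)) js) =
    (\<Sum>ws | set ws \<subseteq> I \<and> length ws = length js.
      Poly_Mapping.single (sum_list (map e ws)) (prod_list (map2 h js ws)))"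
proof (induction js)
  case Nil
  have "{ws. set ws \<subseteq> I \<and> length ws = 0} = {[]}" by auto
  then show ?case by simp
next
  case (Cons j js)
  let ?L = "{ws. set ws \<subseteq> I \<and> length ws = length js}"
  have "inj_on (\<lambda>(ws, v). v # ws) (?L \<times> I)"
    by (auto simp: inj_on_def)
  then have "(\<Sum>ws | set ws \<subseteq> I \<and> length ws = length (j # js).
      Poly_Mapping.single (sum_list (map e ws)) (prod_list (map2 h (j # js) ws))) =
    (\<Sum>(ws, v)\<in>?L \<times> I. Poly_Mapping.single (e v + sum_list (map e ws)) (h j v * prod_list (map2 h js ws)))"
    by (simp add: lists_length_Suc_eq sum.reindex case_prod_unfold)
  also have "\<dots> = (\<Sum>ws\<in>?L. \<Sum>v\<in>I. Poly_Mapping.single (e v) (h j v) *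
      Poly_Mapping.single (sum_list (map e ws)) (prod_list (map2 h js ws)))"
    by (simp add: sum.cartesian_product mult_single)
  also have "\<dots> = (\<Sum>v\<in>I. Poly_Mapping.single (e v) (h j v)) *
      (\<Sum>ws\<in>?L. Poly_Mapping.single (sum_list (map e ws)) (prod_list (map2 h js ws)))"
    by (subst sum.swap) (simp add: sum_product)
  finally show ?case using Cons by simp
qed

lemma lookup_prod_list_sum_single:
  fixes h :: "'c \<Rightarrow> 'd \<Rightarrow> 'a::comm_semiring_1" and e :: "'d \<Rightarrow> 'b::cancel_comm_monoid_add"
  assumes "finite I"
  shows "Poly_Mapping.lookup (prod_list (map (\<lambda>j. \<Sum>v\<in>I. Poly_Mapping.single (e v) (h j v)) js)) V =
    (\<Sum>ws | set ws \<subseteq> I \<and> length ws = length js \<and> sum_list (map e ws) = V. prod_list (map2 h js ws))"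
proof -
  have "finite {ws. set ws \<subseteq> I \<and> length ws = length js}"
    using assms by (rule finite_lists_length_eq)
  then show ?thesis
    unfolding prod_list_sum_single[OF assms] lookup_sum lookup_single when_def
    by (subst sum.inter_filter[symmetric]) (auto intro!: sum.cong)
qed

lemma lookup_sum_single_power:
  fixes h :: "'d \<Rightarrow> 'a::comm_semiring_1" and e :: "'d \<Rightarrow> 'b::cancel_comm_monoid_add"
  assumes "finite I"
  shows "Poly_Mapping.lookup ((\<Sum>v\<in>I. Poly_Mapping.single (e v) (h v)) ^ k) V =
    (\<Sum>ws | set ws \<subseteq> I \<and> length ws = k \<and> sum_list (map e ws) = V. prod_list (map h ws))"
proof -
  have "map2 (\<lambda>_. h) (replicate k ()) ws = map h ws" if "length ws = k" for ws
    using that by (intro nth_equalityI) auto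
  then show ?thesis
    using lookup_prod_list_sum_single[OF assms, of e "\<lambda>_. h" "replicate k ()" V]
    by (auto simp: map_replicate_const intro!: sum.cong)
qed

lemma (in subring_set) lookup_power_cong:
  fixes e :: "'b::cancel_comm_monoid_add \<Rightarrow> 'b"
  assumes p: "prime p"
    and e: "\<And>v c. Poly_Mapping.single v (c :: 'a) ^ p = Poly_Mapping.single (e v) (c ^ p)"
    and h: "\<And>v. v \<in> I \<Longrightarrow> h v \<in> R" "\<And>v. v \<in> I \<Longrightarrow> h' v \<in> R"
    and hh': "\<And>v. v \<in> I \<Longrightarrow> cong_in p (h v ^ p) (h' v)"
  shows "cong_in (p ^ Suc k)
    (Poly_Mapping.lookup ((\<Sum>v\<in>I. Poly_Mapping.single v (h v)) ^ (p ^ Suc k * s)) V)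
    (Poly_Mapping.lookup ((\<Sum>v\<in>I. Poly_Mapping.single (e v) (h' v)) ^ (p ^ k * s)) V)"
proof -
  define P where "P = {Q :: 'b \<Rightarrow>\<^sub>0 'a. \<forall>v. Poly_Mapping.lookup Q v \<in> R}"
  interpret P: subring_set P
    unfolding P_def by (rule subring_set_poly_mapping) unfold_locales
  have single: "Poly_Mapping.single v c \<in> P" if "c \<in> R" for v c
    using that by (auto simp: P_def lookup_single when_def zero_closed)
  let ?A = "\<Sum>v\<in>I. Poly_Mapping.single v (h v)"
  let ?A' = "\<Sum>v\<in>I. Poly_Mapping.single (e v) (h' v)"
  have A: "?A \<in> P" "?A' \<in> P"
    using h by (auto intro!: P.sum_closed single)
  have "P.cong_in p (?A ^ p) (\<Sum>v\<in>I. Poly_Mapping.single v (h v) ^ p)"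
    using p by (rule P.cong_in_frobenius_sum) (auto intro: single h)
  also have "P.cong_in p (\<Sum>v\<in>I. Poly_Mapping.single v (h v) ^ p) ?A'"
  proof (rule P.cong_in_sum)
    fix v assume "v \<in> I"
    then obtain c where c: "c \<in> R" "h v ^ p - h' v = of_nat p * c"
      using hh' by (auto simp: cong_in_def)
    have "Poly_Mapping.single v (h v) ^ p - Poly_Mapping.single (e v) (h' v) =
        of_nat p * Poly_Mapping.single (e v) c"
      by (simp add: e c(2) mult_single flip: single_diff single_of_nat)
    then show "P.cong_in p (Poly_Mapping.single v (h v) ^ p) (Poly_Mapping.single (e v) (h' v))"
      unfolding P.cong_in_def using c(1) single by blast
  qed
  finally (P.cong_in_trans) have "P.cong_in p (?A ^ p) ?A'" .
  then have "P.cong_in (p ^ Suc k) ((?A ^ p) ^ (p ^ k)) (?A' ^ (p ^ k))"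
    by (rule P.cong_in_prime_power) (auto intro: P.power_closed A)
  then have "P.cong_in (p ^ Suc k) (((?A ^ p) ^ (p ^ k)) ^ s) ((?A' ^ (p ^ k)) ^ s)"
    by (rule P.cong_in_power) (auto intro: P.power_closed A)
  then have "P.cong_in (p ^ Suc k) (?A ^ (p ^ Suc k * s)) (?A' ^ (p ^ k * s))"
    by (simp add: power_mult)
  then obtain C where C: "C \<in> P" "?A ^ (p ^ Suc k * s) - ?A' ^ (p ^ k * s) = of_nat (p ^ Suc k) * C"
    unfolding P.cong_in_def by blast
  have "Poly_Mapping.lookup (of_nat n * C) V = of_nat n * Poly_Mapping.lookup C V" for n
    by (induction n) (auto simp: lookup_add algebra_simps)
  then have "Poly_Mapping.lookup (?A ^ (p ^ Suc k * s)) V - Poly_Mapping.lookup (?A' ^ (p ^ k * s)) V =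
      of_nat (p ^ Suc k) * Poly_Mapping.lookup C V"
    by (metis C(2) lookup_minus)
  then show ?thesis
    unfolding cong_in_def using C(1) by (auto simp: P_def)
qed

section \<open>Rational functions with monic integral denominators\<close>

lemma coeff_rat_of_int_poly [simp]: "coeff (rat_of_int_poly a) i = of_int (coeff a i)"
  by (simp add: rat_of_int_poly_def coeff_map_poly)

lemma rat_of_int_poly_simps [simp]:
  "rat_of_int_poly 0 = 0"
  "rat_of_int_poly 1 = 1"
  "rat_of_int_poly (a + b) = rat_of_int_poly a + rat_of_int_poly b"
  "rat_of_int_poly (a - b) = rat_of_int_poly a - rat_of_int_poly b"
  "rat_of_int_poly (- a) = - rat_of_int_poly a"
  "rat_of_int_poly (pCons c a) = pCons (of_int c) (rat_of_int_poly a)"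
  by (auto simp: poly_eq_iff coeff_pCons split: nat.splits)

lemma rat_of_int_poly_mult [simp]:
  "rat_of_int_poly (a * b) = rat_of_int_poly a * rat_of_int_poly b"
  by (simp add: poly_eq_iff coeff_mult)

lemma rat_of_int_poly_power [simp]: "rat_of_int_poly (a ^ n) = rat_of_int_poly a ^ n"
  by (induction n) auto

lemma rat_of_int_poly_pcompose [simp]:
  "rat_of_int_poly (pcompose a q) = pcompose (rat_of_int_poly a) (rat_of_int_poly q)"
  by (induction a) (auto simp: pcompose_pCons)

lemma rat_of_int_poly_of_nat [simp]: "rat_of_int_poly (of_nat n) = of_nat n"
  by (induction n) auto

lemma to_fract_of_nat [simp]: "to_fract (of_nat n) = of_nat n"
  by (induction n) auto

lemma to_fract_power [simp]: "to_fract (x ^ n) = to_fract x ^ n"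
  by (induction n) auto

lemma rat_of_int_poly_eq_0_iff [simp]: "rat_of_int_poly a = 0 \<longleftrightarrow> a = 0"
  by (simp add: poly_eq_iff)

lemma degree_rat_of_int_poly [simp]: "degree (rat_of_int_poly a) = degree a"
  unfolding rat_of_int_poly_def by (rule degree_map_poly) simp

lemma Fract_in_L_ring:
  assumes "lead_coeff b = 1"
  shows "Fract (rat_of_int_poly a) (rat_of_int_poly b) \<in> L_ring"
  unfolding L_ring_def using assms by (intro CollectI exI conjI) auto

lemma L_ringE:
  assumes "h \<in> L_ring"
  obtains a b where "h = Fract (rat_of_int_poly a) (rat_of_int_poly b)" "lead_coeff b = 1" "b \<noteq> 0"
  using assms by (auto simp: L_ring_def)

lemma int_poly_in_L_ring: "to_fract (rat_of_int_poly a) \<in> L_ring"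
  using Fract_in_L_ring[of 1 a] by (simp add: to_fract_def)

lemma X_fract_in_L_ring: "X_fract \<in> L_ring"
  using int_poly_in_L_ring[of "[:0, 1:]"] by (simp add: X_fract_def)

lemma subring_set_L_ring: "subring_set L_ring"
proof
  show "0 \<in> L_ring" "1 \<in> L_ring"
    using int_poly_in_L_ring[of 0] int_poly_in_L_ring[of 1] by simp_all
next
  fix h k assume "h \<in> L_ring" "k \<in> L_ring"
  then obtain a b c d where
    h: "h = Fract (rat_of_int_poly a) (rat_of_int_poly b)" "lead_coeff b = 1" "b \<noteq> 0" and
    k: "k = Fract (rat_of_int_poly c) (rat_of_int_poly d)" "lead_coeff d = 1" "d \<noteq> 0"
    by (metis L_ringE)
  have bd: "lead_coeff (b * d) = 1"
    using h k by (simp add: lead_coeff_mult)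
  show "h * k \<in> L_ring"
    using Fract_in_L_ring[OF bd, of "a * c"] h k by simp
  show "h + k \<in> L_ring"
    using Fract_in_L_ring[OF bd, of "a * d + c * b"] h k by simp
  show "- h \<in> L_ring"
    using Fract_in_L_ring[OF h(2), of "- a"] h by simp
qed

interpretation L: subring_set L_ring
  by (rule subring_set_L_ring)

lemma fract_poly_cases:
  obtains a b where "h = Fract a b" "b \<noteq> (0 :: rat poly)"
  by (cases h) auto

lemma subst_fract_0 [simp]: "degree q > 0 \<Longrightarrow> subst_fract 0 q = 0"
  and subst_fract_1 [simp]: "degree q > 0 \<Longrightarrow> subst_fract 1 q = 1"
  using subst_fract_Fract[of q 1 0] subst_fract_Fract[of q 1 1]
  by (simp_all add: Zero_fract_def One_fract_def pcompose_1)

lemma subst_fract_add_mult: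
  assumes "degree q > 0"
  shows "subst_fract (h + k) q = subst_fract h q + subst_fract k q"
    and "subst_fract (h * k) q = subst_fract h q * subst_fract k q"
proof -
  obtain a b c d where h: "h = Fract a b" "b \<noteq> 0" and k: "k = Fract c d" "d \<noteq> 0"
    by (metis fract_poly_cases)
  have nz: "pcompose b q \<noteq> 0" "pcompose d q \<noteq> 0"
    using assms h k pcompose_eq_0 by blast+
  show "subst_fract (h + k) q = subst_fract h q + subst_fract k q"
    using h k nz assms by (simp add: subst_fract_Fract pcompose_add pcompose_mult)
  show "subst_fract (h * k) q = subst_fract h q * subst_fract k q"
    using h k nz assms by (simp add: subst_fract_Fract pcompose_mult)
qed

lemma subst_fract_uminus:
  assumes "degree q > 0"
  shows "subst_fract (- h) q = - subst_fract h q"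
  using subst_fract_add_mult(1)[OF assms, of h "- h"] assms by (simp add: eq_neg_iff_add_eq_0 add.commute)

lemma subst_fract_sum:
  assumes "degree q > 0"
  shows "subst_fract (sum h I) q = (\<Sum>i\<in>I. subst_fract (h i) q)"
  by (induction I rule: infinite_finite_induct) (auto simp: subst_fract_add_mult assms)

lemma subst_fract_prod:
  assumes "degree q > 0"
  shows "subst_fract (prod h I) q = (\<Prod>i\<in>I. subst_fract (h i) q)"
  by (induction I rule: infinite_finite_induct) (auto simp: subst_fract_add_mult assms)

lemma lead_coeff_pcompose_monic:
  fixes b q :: "int poly"
  assumes "lead_coeff b = 1" "lead_coeff q = 1" "degree q > 0"
  shows "lead_coeff (pcompose b q) = 1"
  using lead_coeff_comp[of q b] assms by simp

lemma subst_fract_in_L_ring: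
  assumes "h \<in> L_ring" "lead_coeff q = 1" "degree q > 0"
  shows "subst_fract h (rat_of_int_poly q) \<in> L_ring"
proof -
  obtain a b where h: "h = Fract (rat_of_int_poly a) (rat_of_int_poly b)" "lead_coeff b = 1" "b \<noteq> 0"
    using assms(1) by (rule L_ringE)
  show ?thesis
    using Fract_in_L_ring[OF lead_coeff_pcompose_monic[OF h(2) assms(2,3)], of "pcompose a q"] h(3) assms(3)
    by (simp add: h(1) subst_fract_Fract)
qed

interpretation Z: subring_set "UNIV :: int poly set"
  by standard auto

lemma pcompose_frobenius:
  fixes a q q' :: "int poly"
  assumes "prime p" "of_nat p dvd q ^ p - q'"
  shows "of_nat p dvd pcompose a q ^ p - pcompose a q'"
proof (induction a)
  case 0
  then show ?case using prime_gt_0_nat[OF assms(1)] by (simp add: power_0_left)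
next
  case (pCons c a)
  have Z: "Z.cong_in p x y \<longleftrightarrow> of_nat p dvd x - y" for x y
    by (auto simp: Z.cong_in_def dvd_def)
  have c: "Z.cong_in p ([:c:] ^ p) [:c:]"
    using Z.cong_in_fermat[OF assms(1), of c] by (simp add: of_int_poly)
  have "Z.cong_in p (([:c:] + q * pcompose a q) ^ p) ([:c:] ^ p + (q * pcompose a q) ^ p)"
    using assms(1) by (rule Z.cong_in_frobenius) auto
  also have "Z.cong_in p ([:c:] ^ p + (q * pcompose a q) ^ p) ([:c:] + q' * pcompose a q')"
    unfolding power_mult_distrib using assms(2) pCons
    by (intro Z.cong_in_add Z.cong_in_mult c) (auto simp: Z)
  finally (Z.cong_in_trans) show ?case
    by (simp add: Z pcompose_pCons)
qed

lemma subst_fract_frobenius: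
  assumes p: "prime p" "of_nat p dvd q ^ p - q'"
    and q: "lead_coeff q = 1" "degree q > 0" and q': "lead_coeff q' = 1" "degree q' > 0"
    and "h \<in> L_ring"
  shows "L.cong_in p (subst_fract h (rat_of_int_poly q) ^ p) (subst_fract h (rat_of_int_poly q'))"
proof -
  obtain a b where h: "h = Fract (rat_of_int_poly a) (rat_of_int_poly b)" "lead_coeff b = 1" "b \<noteq> 0"
    using assms(7) by (rule L_ringE)
  let ?c = "\<lambda>a q. pcompose a q"
  obtain u where u: "?c a q ^ p - ?c a q' = of_nat p * u"
    using pcompose_frobenius[OF p, of a] by (rule dvdE)
  obtain w where w: "?c b q ^ p - ?c b q' = of_nat p * w"
    using pcompose_frobenius[OF p, of b] by (rule dvdE)
  have b: "lead_coeff (?c b q) = 1" "lead_coeff (?c b q') = 1"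
    using lead_coeff_pcompose_monic h q q' by blast+
  then have bb: "lead_coeff (?c b q ^ p * ?c b q') = 1"
    by (simp add: lead_coeff_mult lead_coeff_power)
  define d where "d = u * ?c b q' - ?c a q' * w"
  have "?c a q ^ p * ?c b q' - ?c a q' * ?c b q ^ p = of_nat p * d"
    using u w by (simp add: d_def algebra_simps eq_diff_eq diff_eq_eq)
  then have eq: "rat_of_int_poly (?c a q) ^ p * rat_of_int_poly (?c b q') -
     rat_of_int_poly (?c a q') * rat_of_int_poly (?c b q) ^ p = of_nat p * rat_of_int_poly d"
    by (metis rat_of_int_poly_mult rat_of_int_poly_power rat_of_int_poly_simps(4) 
        rat_of_int_poly_of_nat)
  have nz: "rat_of_int_poly (?c b q) \<noteq> 0" "rat_of_int_poly (?c b q') \<noteq> 0"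
    using b by (auto simp del: rat_of_int_poly_pcompose)
  have sub: "subst_fract h (rat_of_int_poly q) = to_fract (rat_of_int_poly (?c a q)) / to_fract (rat_of_int_poly (?c b q))"
    "subst_fract h (rat_of_int_poly q') = to_fract (rat_of_int_poly (?c a q')) / to_fract (rat_of_int_poly (?c b q'))"
    using h q q' by (simp_all add: subst_fract_Fract flip: Fract_conv_to_fract)
  have "subst_fract h (rat_of_int_poly q) ^ p - subst_fract h (rat_of_int_poly q') =
     to_fract (of_nat p * rat_of_int_poly d) / to_fract (rat_of_int_poly (?c b q ^ p * ?c b q'))"
    unfolding sub eq[symmetric] using nz
    by (simp add: power_divide diff_frac_eq del: rat_of_int_poly_pcompose)
  also have "\<dots> = of_nat p * Fract (rat_of_int_poly d) (rat_of_int_poly (?c b q ^ p * ?c b q'))"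
    by (simp add: Fract_conv_to_fract del: rat_of_int_poly_pcompose)
  finally show ?thesis
    unfolding L.cong_in_def using Fract_in_L_ring[OF bb] by blast
qed

lemma to_fract_in_L_ring:
  assumes "to_fract c \<in> L_ring"
  obtains a where "c = rat_of_int_poly a"
proof -
  obtain a b where "to_fract c = Fract (rat_of_int_poly a) (rat_of_int_poly b)"
    and b: "lead_coeff b = 1" "b \<noteq> 0"
    using assms by (rule L_ringE)
  then have c: "c * rat_of_int_poly b = rat_of_int_poly a"
    by (simp add: to_fract_def eq_fract)
  obtain q r where "pseudo_divmod a b = (q, r)" by fastforce
  from pseudo_divmod[OF b(2) this] b(1)
  have qr: "a = b * q + r" "r = 0 \<or> degree r < degree b" by simp_all
  have "(c - rat_of_int_poly q) * rat_of_int_poly b = rat_of_int_poly r"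
    using c qr(1) by (simp add: algebra_simps)
  moreover have "degree ((c - rat_of_int_poly q) * rat_of_int_poly b) \<ge> degree b"
    if "c - rat_of_int_poly q \<noteq> 0"
    using that b(2) by (subst degree_mult_eq) auto
  ultimately have "c - rat_of_int_poly q = 0"
    using qr(2) b(2) by (cases "c = rat_of_int_poly q") (auto simp: not_less[symmetric])
  then show thesis by (intro that[of q]) simp
qed

definition L_local :: "nat \<Rightarrow> rat poly fract set" where
  "L_local p = {h. \<exists>s. coprime s p \<and> of_nat s * h \<in> L_ring}"

lemma L_ring_subset_L_local: "L_ring \<subseteq> L_local p"
  by (auto simp: L_local_def intro!: exI[of _ 1])

lemma subring_set_L_local: "subring_set (L_local p)"
proof
  show "0 \<in> L_local p" "1 \<in> L_local p"
    using L_ring_subset_L_local L.zero_closed L.one_closed by blast+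
next
  fix h k assume "h \<in> L_local p" "k \<in> L_local p"
  then obtain s t where s: "coprime s p" "of_nat s * h \<in> L_ring" and t: "coprime t p" "of_nat t * k \<in> L_ring"
    by (auto simp: L_local_def)
  have st: "coprime (s * t) p" using s t by simp
  have "of_nat (s * t) * (h + k) = of_nat t * (of_nat s * h) + of_nat s * (of_nat t * k)"
    by (simp add: algebra_simps)
  also have "\<dots> \<in> L_ring"
    by (intro L.add_closed L.mult_closed L.of_nat_closed s t)
  finally show "h + k \<in> L_local p"
    using st unfolding L_local_def by blast
  have "of_nat (s * t) * (h * k) = (of_nat s * h) * (of_nat t * k)"
    by (simp add: algebra_simps)
  also have "\<dots> \<in> L_ring"
    by (intro L.mult_closed s t)
  finally show "h * k \<in> L_local p"
    using st unfolding L_local_def by blast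
  show "- h \<in> L_local p"
    using s L.uminus_closed[OF s(2)] unfolding L_local_def by auto
qed

lemma inverse_of_nat_in_L_local:
  assumes "coprime s p" "s > 0"
  shows "1 / of_nat s \<in> L_local p"
  using assms L.one_closed unfolding L_local_def by (intro CollectI exI[of _ s]) simp

lemma rat_in_Ints_if_locally:
  fixes x :: rat
  assumes "\<And>p. prime p \<Longrightarrow> \<exists>s. coprime s p \<and> of_nat s * x \<in> \<int>"
  shows "x \<in> \<int>"
proof -
  obtain u v where uv: "quotient_of x = (u, v)" by fastforce
  have v: "v > 0" "coprime u v" "x = of_int u / of_int v"
    using uv quotient_of_denom_pos quotient_of_coprime quotient_of_div by blast+
  have "nat v = 1"
  proof (rule ccontr)
    assume "nat v \<noteq> 1"
    then obtain p where p: "prime p" "p dvd nat v"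
      using prime_factor_nat by blast
    obtain s where s: "coprime s p" "of_nat s * x \<in> \<int>"
      using assms p(1) by blast
    then obtain k where "of_nat s * x = of_int k"
      by (auto elim: Ints_cases)
    then have "of_int (int s * u) = (of_int (k * v) :: rat)"
      using v by (simp add: field_simps)
    then have "int s * u = k * v" by (simp only: of_int_eq_iff)
    then have "v dvd int s * u" by simp
    then have "v dvd int s"
      using v(2) by (simp add: coprime_commute coprime_dvd_mult_left_iff)
    then have "nat v dvd s"
      using v(1) by (metis nat_dvd_iff less_le_not_le)
    then have "p dvd s" using p(2) dvd_trans by blast
    then show False
      using s(1) p(1) by (metis coprime_absorb_right not_prime_unit)
  qed
  then have "v = 1" using v(1) by simp
  then show ?thesis using v(3) by simp
qed

lemma int_polys_if_locally:
  assumes "f \<in> rat_polys" "\<And>p. prime p \<Longrightarrow> f \<in> L_local p"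
  shows "f \<in> int_polys"
proof -
  obtain c where c: "f = to_fract c"
    using assms(1) by (auto simp: rat_polys_def)
  have Ints: "coeff c i \<in> \<int>" for i
  proof (rule rat_in_Ints_if_locally)
    fix p :: nat assume "prime p"
    then obtain s where s: "coprime s p" "of_nat s * f \<in> L_ring"
      using assms(2) by (auto simp: L_local_def)
    then have "to_fract (of_nat s * c) \<in> L_ring" by (simp add: c)
    then obtain a where a: "of_nat s * c = rat_of_int_poly a"
      by (rule to_fract_in_L_ring)
    have "of_nat s * coeff c i = coeff (of_nat s * c) i"
      by (simp add: of_nat_poly)
    also have "\<dots> \<in> \<int>" by (simp add: a)
    finally show "\<exists>s. coprime s p \<and> of_nat s * coeff c i \<in> \<int>"
      using s(1) by blast
  qed
  have "c = rat_of_int_poly (map_poly floor c)"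
  proof (rule poly_eqI)
    fix i
    show "coeff c i = coeff (rat_of_int_poly (map_poly floor c)) i"
      using Ints[of i] by (auto simp: coeff_map_poly elim: Ints_cases)
  qed
  then show ?thesis
    unfolding c int_polys_def by (metis rangeI)
qed

section \<open>Sums over words\<close>

definition compositions :: "nat \<Rightarrow> nat list set" where
  "compositions d = {c. (\<forall>k\<in>set c. k \<ge> 1) \<and> sum_list c = d}"

lemma length_composition:
  "c \<in> compositions d \<Longrightarrow> length c \<le> d"
proof -
  have "length c \<le> sum_list c" if "\<forall>k\<in>set c. k \<ge> (1::nat)"
    using that by (induction c) auto
  then show "c \<in> compositions d \<Longrightarrow> length c \<le> d" by (auto simp: compositions_def)
qed

lemma finite_compositions: "finite (compositions d)"
proof (rule finite_subset)
  show "compositions d \<subseteq> {c. set c \<subseteq> {..d} \<and> length c \<le> d}"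
    using length_composition by (fastforce simp: compositions_def dest: member_le_sum_list)
qed (simp add: finite_lists_length_le)

lemma const_fract_simps [simp]:
  "const_fract 0 = 0" "const_fract 1 = 1"
  "const_fract (x + y) = const_fract x + const_fract y"
  "const_fract (x * y) = const_fract x * const_fract y"
  "const_fract (- x) = - const_fract x"
  "const_fract (of_nat n) = of_nat n"
  "const_fract (of_int k) = of_int k"
proof -
  have *: "[:x + y:] = [:x:] + [:y:]" "[:x * y:] = [:x:] * [:y:]" "[:- x:] = - [:x:]" for x y :: rat
    by simp_all
  show "const_fract 0 = 0" "const_fract 1 = 1"
    by (simp_all add: const_fract_def flip: one_pCons)
  show add: "const_fract (x + y) = const_fract x + const_fract y" for x y
    unfolding const_fract_def * to_fract_add ..
  show "const_fract (x * y) = const_fract x * const_fract y"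
    unfolding const_fract_def * to_fract_mult ..
  show uminus: "const_fract (- x) = - const_fract x" for x
    unfolding const_fract_def * to_fract_uminus ..
  show nat: "const_fract (of_nat n) = of_nat n" for n
    by (simp add: const_fract_def flip: of_nat_poly)
  show "const_fract (of_int k) = of_int k"
    by (cases k) (simp_all add: nat uminus del: of_nat_Suc)
qed

lemma const_fract_power [simp]: "const_fract (x ^ n) = const_fract x ^ n"
  by (induction n) auto

lemma const_fract_divide [simp]: "const_fract (x / y) = const_fract x / const_fract y"
proof (cases "y = 0")
  case False
  then have "const_fract (x / y) * const_fract y = const_fract x"
    by (simp flip: const_fract_simps(4))
  moreover have "const_fract y \<noteq> 0"
    using False by (simp add: const_fract_def)
  ultimately show ?thesis by (simp add: field_simps)
qed simp

lemma sum_partitions_eq_sum_compositions: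
  fixes G :: "nat list \<Rightarrow> rat poly fract"
  assumes "d > 0" and sym: "\<And>l l'. mset l = mset l' \<Longrightarrow> G l = G l'"
  shows "(\<Sum>l\<in>partitions d. const_fract (theta l) * G l) =
    (\<Sum>c\<in>compositions d. (- 1) ^ (length c - 1) / of_nat (length c) * G c)"
proof -
  let ?t = "\<lambda>c. (- 1) ^ (length c - 1) / of_nat (length c) * G c"
  let ?s = "\<lambda>c. rev (sort c)"
  have part: "?s c \<in> partitions d" if "c \<in> compositions d" for c
    using that by (auto simp: compositions_def partitions_def sorted_wrt_rev
        simp flip: sum_mset_sum_list)
  have "(\<Sum>c | c \<in> compositions d \<and> ?s c = l. ?t c) = const_fract (theta l) * G l"
    if l: "l \<in> partitions d" for l
  proof -
    have sorted: "sorted (rev l)" and pos: "\<forall>k\<in>set l. k \<ge> 1" and sum: "sum_list l = d"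
      using l by (auto simp: partitions_def sorted_wrt_rev)
    have "{c. c \<in> compositions d \<and> ?s c = l} = permutations_of_multiset (mset l)"
    proof (intro equalityI subsetI)
      fix c assume "c \<in> permutations_of_multiset (mset l)"
      then have c: "mset c = mset l" by (simp add: permutations_of_multiset_def)
      then have "sort c = rev l" using sorted by (metis mset_rev properties_for_sort)
      moreover have "set c = set l" "sum_list c = sum_list l"
        using c by (metis set_mset_mset, metis sum_mset_sum_list)
      ultimately show "c \<in> {c. c \<in> compositions d \<and> ?s c = l}"
        using pos sum by (simp add: compositions_def)
    qed (auto simp: permutations_of_multiset_def)
    then have "(\<Sum>c | c \<in> compositions d \<and> ?s c = l. ?t c) =
        (\<Sum>c\<in>permutations_of_multiset (mset l). ?t l)"
    proof (rule sum.cong)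
      fix c assume "c \<in> permutations_of_multiset (mset l)"
      then have "mset c = mset l" by (simp add: permutations_of_multiset_def)
      then show "?t c = ?t l" using sym[of c l] mset_eq_length[of c l] by simp
    qed
    also have "\<dots> = of_nat (card (permutations_of_multiset (mset l))) * ?t l"
      by simp
    also have "of_nat (card (permutations_of_multiset (mset l))) =
        const_fract (fact (length l) / (\<Prod>i\<in>set l. fact (count_list l i)))"
    proof -
      have "card (permutations_of_multiset (mset l)) * (\<Prod>i\<in>set l. fact (count_list l i)) = fact (length l)"
        using card_permutations_of_multiset_aux[of "mset l"] by (simp add: count_mset)
      then have "of_nat (card (permutations_of_multiset (mset l))) * (\<Prod>i\<in>set l. fact (count_list l i)) =
          (fact (length l) :: rat)"
        by (metis (mono_tags, lifting) of_nat_fact of_nat_mult of_nat_prod prod.cong)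
      moreover have "(\<Prod>i\<in>set l. fact (count_list l i)) \<noteq> (0 :: rat)" by simp
      ultimately have "fact (length l) / (\<Prod>i\<in>set l. fact (count_list l i)) =
          (of_nat (card (permutations_of_multiset (mset l))) :: rat)"
        by (simp add: divide_eq_eq)
      then show ?thesis by (simp del: const_fract_divide)
    qed
    also have "\<dots> * ?t l = const_fract (theta l) * G l"
    proof -
      have "l \<noteq> []" using sum assms(1) by auto
      then obtain n where n: "length l = Suc n" by (cases l) auto
      have "?t l = const_fract ((- 1) ^ n / of_nat (Suc n)) * G l"
        by (simp add: n del: of_nat_Suc)
      moreover have "fact (length l) / (\<Prod>i\<in>set l. fact (count_list l i)) * ((- 1) ^ n / of_nat (Suc n)) = theta l"
        by (simp add: theta_def n field_simps del: of_nat_Suc)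
      ultimately show ?thesis
        by (metis const_fract_simps(4) mult.assoc)
    qed
    finally show ?thesis .
  qed
  then have "(\<Sum>l\<in>partitions d. const_fract (theta l) * G l) =
      (\<Sum>l\<in>partitions d. \<Sum>c | c \<in> compositions d \<and> ?s c = l. ?t c)"
    by simp
  also have "\<dots> = (\<Sum>c\<in>compositions d. ?t c)"
    using part by (intro sum.group finite_partitions finite_compositions) auto
  finally show ?thesis .
qed

lemma member_le_sum_list_vec: "v \<in> set Ss \<Longrightarrow> v \<le> sum_list Ss" for v :: "nat ^ 'm::finite"
  by (induction Ss) (auto simp: less_eq_vec_def intro: le_add1 trans_le_add2)

lemma finite_le_vec: "finite {v. v \<le> (S :: nat ^ 'm::finite)}"
proof (rule finite_subset)
  show "{v. v \<le> S} \<subseteq> hd ` tuples 2 S"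
  proof
    fix v assume "v \<in> {v. v \<le> S}"
    then have "[v, S - v] \<in> tuples 2 S"
      by (auto simp: tuples_def vec_eq_iff less_eq_vec_def)
    then show "v \<in> hd ` tuples 2 S" by force
  qed
qed (simp add: finite_tuples)

lemma g_part_eq_sum_prod_list:
  "g_part g l S = (\<Sum>Ss\<in>tuples (length l) S. prod_list (map2 g l Ss))"
  unfolding g_part_def
  by (rule sum.cong) (auto simp: prod.list_conv_set_nth atLeast0LessThan tuples_def)

lemma g_part_eq_lookup:
  "g_part g l S = Poly_Mapping.lookup
    (prod_list (map (\<lambda>c. \<Sum>T | T \<le> S. Poly_Mapping.single T (g c T)) l)) S"
proof -
  have "tuples (length l) S = {Ss. set Ss \<subseteq> {T. T \<le> S} \<and> length Ss = length l \<and> sum_list Ss = S}"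
    by (auto simp: tuples_def intro: member_le_sum_list_vec)
  then show ?thesis
    using lookup_prod_list_sum_single[OF finite_le_vec[of S], of "\<lambda>T. T" g l S]
    by (simp add: g_part_eq_sum_prod_list)
qed

lemma g_part_cong_mset:
  assumes "mset l = mset l'"
  shows "g_part g l S = g_part g l' S"
proof -
  have "prod_list (map F l) = prod_list (map F l')" for F :: "nat \<Rightarrow> (nat ^ 'a) \<Rightarrow>\<^sub>0 rat poly fract"
    using assms by (simp flip: prod_mset_prod_list)
  then show ?thesis by (simp add: g_part_eq_lookup)
qed

definition words :: "(nat \<times> (nat ^ 'm::finite)) list set" where
  "words = {w. \<forall>v\<in>set w. fst v \<ge> 1}"

text \<open>
  If \<open>X\<close> consists of the words with sum \<open>V\<close>, then \<open>log_coeff h X\<close> is the coefficient at \<open>V\<close> of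
  \<open>-log (1 - \<Sum>\<^sub>v h(v) z\<^sup>v)\<close>.
\<close>

definition log_coeff ::
  "(nat \<times> (nat ^ 'm::finite) \<Rightarrow> rat poly fract) \<Rightarrow> (nat \<times> (nat ^ 'm)) list set \<Rightarrow> rat poly fract" where
  "log_coeff h X = (\<Sum>w\<in>X. prod_list (map h w) / of_nat (length w))"

lemma fst_sum_list: "fst (sum_list w) = sum_list (map fst w)"
  and snd_sum_list: "snd (sum_list w) = sum_list (map snd w)"
  by (induction w) auto

lemma sum_partitions_eq_log_coeff:
  assumes "d > 0"
  shows "(\<Sum>l\<in>partitions d. const_fract (theta l) * g_part g l S) =
    - log_coeff (\<lambda>(c, T). - g c T) {w\<in>words. sum_list w = (d, S)}"
proof -
  let ?k = "\<lambda>n. (- 1) ^ (n - 1) / of_nat n :: rat poly fract"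
  have "(\<Sum>l\<in>partitions d. const_fract (theta l) * g_part g l S) =
      (\<Sum>c\<in>compositions d. ?k (length c) * g_part g c S)"
    using assms by (intro sum_partitions_eq_sum_compositions g_part_cong_mset)
  also have "\<dots> = (\<Sum>(c, Ss)\<in>(SIGMA c:compositions d. tuples (length c) S).
      ?k (length c) * prod_list (map2 g c Ss))"
    by (subst sum.Sigma[symmetric])
      (auto simp: finite_compositions finite_tuples g_part_eq_sum_prod_list sum_distrib_left)
  also have "\<dots> = (\<Sum>w | w \<in> words \<and> sum_list w = (d, S).
      ?k (length w) * prod_list (map (\<lambda>(c, T). g c T) w))"
    by (rule sum.reindex_bij_witness[where i = "\<lambda>w. (map fst w, map snd w)" and j = "\<lambda>(c, Ss). zip c Ss"])
      (auto simp: words_def compositions_def tuples_def prod_eq_iff fst_sum_list snd_sum_list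
        zip_map_fst_snd dest: set_zip_leftD)
  also have "\<dots> = (\<Sum>w | w \<in> words \<and> sum_list w = (d, S).
      - (prod_list (map (\<lambda>(c, T). - g c T) w) / of_nat (length w)))"
  proof (rule sum.cong)
    fix w assume "w \<in> {w. w \<in> words \<and> sum_list w = (d, S)}"
    then have "w \<noteq> []" using assms by (auto simp: zero_prod_def)
    moreover have "prod_list (map (\<lambda>(c, T). - g c T) w) =
        (- 1) ^ length w * prod_list (map (\<lambda>(c, T). g c T) w)"
      by (induction w) auto
    ultimately show "?k (length w) * prod_list (map (\<lambda>(c, T). g c T) w) =
        - (prod_list (map (\<lambda>(c, T). - g c T) w) / of_nat (length w))"
      by (cases w) auto
  qed simp
  also have "\<dots> = - log_coeff (\<lambda>(c, T). - g c T) {w\<in>words. sum_list w = (d, S)}"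
    by (simp add: log_coeff_def sum_negf)
  finally show ?thesis .
qed

definition scale_idx :: "nat \<Rightarrow> nat \<times> (nat ^ 'm::finite) \<Rightarrow> nat \<times> (nat ^ 'm)" where
  "scale_idx k v = (k * fst v, \<chi> i. k * snd v $ i)"

lemma scale_idx_inject: "k > 0 \<Longrightarrow> scale_idx k v = scale_idx k w \<longleftrightarrow> v = w"
  by (auto simp: scale_idx_def prod_eq_iff vec_eq_iff)

lemma scale_idx_sum_list: "scale_idx k (sum_list w) = sum_list (map (scale_idx k) w)"
  by (induction w) (auto simp: scale_idx_def prod_eq_iff vec_eq_iff algebra_simps)

lemma single_power:
  "Poly_Mapping.single v (c :: 'a::comm_semiring_1) ^ k = Poly_Mapping.single (scale_idx k v) (c ^ k)"
proof (induction k)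
  case 0
  have "scale_idx 0 v = 0" by (simp add: scale_idx_def prod_eq_iff vec_eq_iff)
  then show ?case by simp
next
  case (Suc k)
  have "v + scale_idx k v = scale_idx (Suc k) v"
    by (simp add: scale_idx_def prod_eq_iff vec_eq_iff)
  then show ?case by (simp add: Suc mult_single)
qed

lemma log_coeff_eq_sum_lookup:
  fixes e :: "nat \<times> (nat ^ 'm::finite) \<Rightarrow> 'b::cancel_comm_monoid_add"
  assumes X: "X = {w\<in>words. sum_list (map e w) = V}" "X \<subseteq> {w. set w \<subseteq> I \<and> length w \<in> N}"
    and I: "finite I" "\<And>v. v \<in> I \<Longrightarrow> fst v \<ge> 1" and "finite N"
  shows "log_coeff h X = (\<Sum>k\<in>N.
    Poly_Mapping.lookup ((\<Sum>v\<in>I. Poly_Mapping.single (e v) (h v)) ^ k) V / of_nat k)"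
proof -
  have "X \<subseteq> (\<Union>k\<in>N. {w. set w \<subseteq> I \<and> length w = k})" using X(2) by auto
  moreover have "finite (\<Union>k\<in>N. {w. set w \<subseteq> I \<and> length w = k})"
    using assms finite_lists_length_eq by blast
  ultimately have "finite X" using finite_subset by blast
  then have "log_coeff h X =
      (\<Sum>k\<in>N. \<Sum>w | w \<in> X \<and> length w = k. prod_list (map h w) / of_nat (length w))"
    unfolding log_coeff_def using X(2) assms(5) by (intro sum.group[symmetric]) auto
  also have "\<dots> = (\<Sum>k\<in>N. (\<Sum>w | set w \<subseteq> I \<and> length w = k \<and> sum_list (map e w) = V.
      prod_list (map h w)) / of_nat k)"
  proof (rule sum.cong)
    fix k assume "k \<in> N"
    have "{w. w \<in> X \<and> length w = k} = {w. set w \<subseteq> I \<and> length w = k \<and> sum_list (map e w) = V}"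
      using X I(2) by (auto simp: words_def)
    then show "(\<Sum>w | w \<in> X \<and> length w = k. prod_list (map h w) / of_nat (length w)) =
      (\<Sum>w | set w \<subseteq> I \<and> length w = k \<and> sum_list (map e w) = V. prod_list (map h w)) / of_nat k"
      by (auto simp: sum_divide_distrib intro!: sum.cong)
  qed simp
  finally show ?thesis
    by (simp add: lookup_sum_single_power[OF I(1)])
qed

lemma member_word_le:
  fixes v :: "nat \<times> (nat ^ 'm::finite)"
  assumes "v \<in> set w"
  shows "fst v \<le> fst (sum_list w)" "snd v \<le> snd (sum_list w)"
  using assms member_le_sum_list[of "fst v" "map fst w"] member_le_sum_list_vec[of "snd v" "map snd w"]
  by (auto simp: fst_sum_list snd_sum_list)

lemma length_word_le:
  "w \<in> words \<Longrightarrow> length w \<le> fst (sum_list w)"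
  by (induction w) (auto simp: words_def)

lemma log_coeff_frobenius:
  fixes h h' :: "nat \<times> (nat ^ 'm::finite) \<Rightarrow> rat poly fract"
  assumes p: "prime p"
    and h: "\<And>v. fst v \<ge> 1 \<Longrightarrow> h v \<in> L_ring" "\<And>v. fst v \<ge> 1 \<Longrightarrow> h' v \<in> L_ring"
    and hh': "\<And>v. fst v \<ge> 1 \<Longrightarrow> L.cong_in p (h v ^ p) (h' v)"
    and V: "fst V > 0"
  shows "log_coeff h {w\<in>words. sum_list w = V} -
    log_coeff h' {w\<in>words. scale_idx p (sum_list w) = V} / of_nat p \<in> L_local p"
proof -
  interpret loc: subring_set "L_local p" by (rule subring_set_L_local)
  have p0: "p > 0" using p by (rule prime_gt_0_nat)
  define I where "I = {v :: nat \<times> (nat ^ 'm). fst v \<in> {1..fst V} \<and> snd v \<le> snd V}"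
  have I: "finite I" "\<And>v. v \<in> I \<Longrightarrow> fst v \<ge> 1"
  proof -
    have "I = {1..fst V} \<times> {T. T \<le> snd V}" by (auto simp: I_def)
    then show "finite I" by (simp add: finite_le_vec)
  qed (auto simp: I_def)
  define N where "N = {1..fst V}"
  define M where "M = {k. p * k \<in> N}"
  have M: "M \<subseteq> N" "finite N"
  proof -
    have le: "k \<le> p * k" for k using p0 by simp
    show "M \<subseteq> N"
      using order_trans[OF le] by (auto simp: M_def N_def Suc_le_eq)
  qed (simp add: N_def)
  let ?a = "\<lambda>k. Poly_Mapping.lookup ((\<Sum>v\<in>I. Poly_Mapping.single v (h v)) ^ k) V"
  let ?b = "\<lambda>k. Poly_Mapping.lookup ((\<Sum>v\<in>I. Poly_Mapping.single (scale_idx p v) (h' v)) ^ k) V"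
  have A: "log_coeff h {w\<in>words. sum_list w = V} = (\<Sum>k\<in>N. ?a k / of_nat k)"
  proof (rule log_coeff_eq_sum_lookup[OF _ _ I M(2)])
    show "{w\<in>words. sum_list w = V} \<subseteq> {w. set w \<subseteq> I \<and> length w \<in> N}"
      using V length_word_le member_word_le
      by (fastforce simp: I_def N_def words_def Suc_le_eq)
  qed simp
  have "log_coeff h' {w\<in>words. scale_idx p (sum_list w) = V} = (\<Sum>k\<in>M. ?b k / of_nat k)"
  proof (rule log_coeff_eq_sum_lookup[OF _ _ I])
    show "{w\<in>words. scale_idx p (sum_list w) = V} \<subseteq> {w. set w \<subseteq> I \<and> length w \<in> M}"
    proof safe
      fix w assume w: "w \<in> words" and "V = scale_idx p (sum_list w)"
      then have V': "fst V = p * fst (sum_list w)" "\<And>i. snd V $ i = p * snd (sum_list w) $ i"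
        by (simp_all add: scale_idx_def)
      then have le: "fst (sum_list w) \<le> fst V" "snd (sum_list w) \<le> snd V"
        using p0 by (auto simp: less_eq_vec_def)
      show "v \<in> I" if "v \<in> set w" for v
        using that w member_word_le[OF that] le by (auto simp: I_def words_def)
      have "w \<noteq> []" using V V' by auto
      then have "1 \<le> p * length w" using p0 by (simp add: Suc_le_eq)
      moreover have "p * length w \<le> fst V"
        using length_word_le[OF w] V' by simp
      ultimately show "length w \<in> M"
        unfolding M_def N_def by simp
    qed
  qed (use M finite_subset in \<open>auto simp: scale_idx_sum_list\<close>)
  then have "log_coeff h' {w\<in>words. scale_idx p (sum_list w) = V} / of_nat p =
      (\<Sum>k\<in>M. ?b k / of_nat (p * k))"
    by (simp add: sum_divide_distrib mult.commute)
  also have "\<dots> = (\<Sum>k | k \<in> N \<and> p dvd k. ?b (k div p) / of_nat k)"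
    by (rule sum.reindex_bij_witness[where i = "\<lambda>k. k div p" and j = "\<lambda>k. p * k"])
      (use p0 in \<open>auto simp: M_def\<close>)
  also have "\<dots> = (\<Sum>k\<in>N. if p dvd k then ?b (k div p) / of_nat k else 0)"
    using M(2) by (rule sum.inter_filter)
  finally have B: "log_coeff h' {w\<in>words. scale_idx p (sum_list w) = V} / of_nat p =
      (\<Sum>k\<in>N. if p dvd k then ?b (k div p) / of_nat k else 0)" .
  have "log_coeff h {w\<in>words. sum_list w = V} -
      log_coeff h' {w\<in>words. scale_idx p (sum_list w) = V} / of_nat p =
    (\<Sum>k\<in>N. ?a k / of_nat k - (if p dvd k then ?b (k div p) / of_nat k else 0))"
    by (simp add: A B sum_subtractf)
  also have "\<dots> \<in> L_local p"
  proof (rule loc.sum_closed)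
    fix k assume "k \<in> N"
    then have "k \<noteq> 0" by (auto simp: N_def)
    then obtain s where k: "k = p ^ multiplicity p k * s" "\<not> p dvd s"
      using multiplicity_decompose'[of k p] p by (metis not_prime_unit)
    have s: "1 / of_nat s \<in> L_local p"
      using k p \<open>k \<noteq> 0\<close> by (intro inverse_of_nat_in_L_local)
        (auto simp: coprime_commute intro: prime_imp_coprime gr0I)
    show "?a k / of_nat k - (if p dvd k then ?b (k div p) / of_nat k else 0) \<in> L_local p"
    proof (cases "multiplicity p k")
      case 0
      then have [simp]: "s = k" "\<not> p dvd k" using k by auto
      have "h v \<in> L_ring" if "v \<in> I" for v using h(1) I(2) that by blast
      then have "x \<in> L_ring" if "x \<in> h ` set w" "set w \<subseteq> I" for x w
        using that by blast
      then have "?a k \<in> L_ring"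
        unfolding lookup_sum_single_power[OF I(1), of "\<lambda>v. v", simplified]
        by (intro L.sum_closed L.prod_list_closed) (simp only: set_map mem_Collect_eq)
      then have "?a k * (1 / of_nat k) \<in> L_local p"
        using s L_ring_subset_L_local by (intro loc.mult_closed) auto
      then show ?thesis by simp
    next
      case (Suc j)
      have k': "k = p ^ Suc j * s" "k div p = p ^ j * s" "p dvd k"
        using k Suc p0 by auto
      have "L.cong_in (p ^ Suc j) (?a (p ^ Suc j * s)) (?b (p ^ j * s))"
        using p by (intro L.lookup_power_cong) (auto intro: single_power I h hh')
      then obtain c where c: "c \<in> L_ring" "?a k - ?b (k div p) = of_nat (p ^ Suc j) * c"
        unfolding L.cong_in_def k'(1,2)[symmetric] by blast
      have "?a k / of_nat k - ?b (k div p) / of_nat k = of_nat (p ^ Suc j) * c / of_nat k"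
        unfolding c(2)[symmetric] by (simp add: diff_divide_distrib)
      also have "\<dots> = c * (1 / of_nat s)"
        using p0 by (subst k'(1)) (simp add: field_simps)
      also have "\<dots> \<in> L_local p"
        using c(1) s L_ring_subset_L_local by (intro loc.mult_closed) auto
      finally show ?thesis using k'(3) by simp
    qed
  qed
  finally show ?thesis .
qed

lemma moebius_prime_mult:
  assumes "prime p" "\<not> p dvd n" "n > 0"
  shows "moebius (p * n) = - moebius n"
proof -
  have "coprime p n" using assms by (simp add: prime_imp_coprime)
  then have "squarefree (p * n) \<longleftrightarrow> squarefree n"
    using squarefree_mult_coprime[of p n] squarefree_prime[OF assms(1)] squarefree_multD(2)[of p n] by blast
  moreover have "prime_factors (p * n) = insert p (prime_factors n)"
    using assms by (auto simp: prime_factors_product prime_prime_factors)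
  moreover have "p \<notin> prime_factors n" using assms by auto
  ultimately show ?thesis by (simp add: moebius_def)
qed

lemma subst_fract_g_part:
  assumes "degree q > 0"
  shows "subst_fract (g_part g l S) q = g_part (\<lambda>c T. subst_fract (g c T) q) l S"
  by (simp add: g_part_def subst_fract_sum subst_fract_prod assms)

lemma mi_size_pos: "S \<noteq> 0 \<Longrightarrow> mi_size S > 0"
  by (auto simp: mi_size_def vec_eq_iff intro: sum_pos2[of UNIV])

lemma mi_dvdD:
  assumes "mi_dvd n S"
  shows "n > 0" "n * mi_div S n $ i = S $ i" "mi_size S = n * mi_size (mi_div S n)"
proof -
  show "n > 0" and *: "n * mi_div S n $ i = S $ i" for i
    using assms by (auto simp: mi_dvd_def mi_div_def)
  show "mi_size S = n * mi_size (mi_div S n)"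
    by (simp add: mi_size_def sum_distrib_left *)
qed

theorem theorem5p1:
  fixes f :: "nat ^ 'm::finite \<Rightarrow> rat poly fract"
    and g :: "nat \<Rightarrow> nat ^ 'm \<Rightarrow> rat poly fract"
    and \<psi> :: "nat \<Rightarrow> int poly"
  assumes f_rat: "\<And>S. S \<noteq> 0 \<Longrightarrow> f S \<in> rat_polys"
    and g_L: "\<And>d S. d \<ge> 1 \<Longrightarrow> g d S \<in> L_ring"
    and psi_monic: "\<And>k. k \<ge> 1 \<Longrightarrow> lead_coeff (\<psi> k) = 1 \<and> degree (\<psi> k) = k"
    and psi_cong: "\<And>p n i. prime p \<Longrightarrow> n \<ge> 1 \<Longrightarrow>
          [coeff (\<psi> (n * p) - \<psi> n ^ p) i = 0] (mod int p)"
    and f_eq: "\<And>S. S \<noteq> 0 \<Longrightarrow>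
          f S = X_fract * (\<Sum>n | mi_dvd n S. const_fract (of_int (moebius n) / of_nat n) *
            (\<Sum>l\<in>partitions (mi_size S div n). const_fract (theta l) *
               subst_fract (g_part g l (mi_div S n)) (rat_of_int_poly (\<psi> n))))"
  shows "\<forall>S. S \<noteq> 0 \<longrightarrow> f S \<in> int_polys"
proof (intro allI impI)
  fix S :: "nat ^ 'm" assume "S \<noteq> 0"
  define h where "h = (\<lambda>n (c, T). subst_fract (- g c T) (rat_of_int_poly (\<psi> n)))"
  define W where "W = (\<lambda>n. {w\<in>words. sum_list w = (mi_size S div n, mi_div S n)})"
  have psi: "lead_coeff (\<psi> n) = 1" "degree (\<psi> n) > 0" if "n > 0" for n
    using psi_monic[of n] that by auto
  have h_L: "h n v \<in> L_ring" if "n > 0" "fst v \<ge> 1" for n v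
    using that psi g_L by (cases v) (auto simp: h_def intro!: subst_fract_in_L_ring L.uminus_closed)
  have pos: "mi_size S div n > 0" if "mi_dvd n S" for n
    using mi_dvdD[OF that] mi_size_pos[OF \<open>S \<noteq> 0\<close>] by (cases "mi_size (mi_div S n)") auto
  have inner: "(\<Sum>l\<in>partitions (mi_size S div n). const_fract (theta l) *
      subst_fract (g_part g l (mi_div S n)) (rat_of_int_poly (\<psi> n))) = - log_coeff (h n) (W n)"
    if "mi_dvd n S" for n
    using psi mi_dvdD(1)[OF that]
    by (simp add: subst_fract_g_part sum_partitions_eq_log_coeff[OF pos[OF that]] subst_fract_uminus h_def W_def)
  have "f S \<in> L_local p" if p: "prime p" for p
  proof -
    interpret loc: subring_set "L_local p" by (rule subring_set_L_local)
    have p0: "p > 0" using p by (rule prime_gt_0_nat)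
    define t where "t = (\<lambda>n. of_int (moebius n) / of_nat n * log_coeff (h n) (W n))"
    define D where "D = {n. mi_dvd n S}"
    have fin: "finite D" using finite_mi_dvd[OF \<open>S \<noteq> 0\<close>] by (simp add: D_def)
    have dvd: "p * n \<in> D \<Longrightarrow> n \<in> D" for n
      by (auto simp: D_def mi_dvd_def dest: dvd_mult_right)
    have "sum t D = (\<Sum>n | n \<in> D \<and> \<not> p dvd n. t n) + (\<Sum>n | n \<in> D \<and> p dvd n. t n)"
      using fin by (subst sum.union_disjoint[symmetric]) (auto intro: sum.cong)
    also have "(\<Sum>n | n \<in> D \<and> p dvd n. t n) = (\<Sum>n | n \<in> D \<and> p dvd n \<and> \<not> p ^ 2 dvd n. t n)"
    proof (rule sum.mono_neutral_right)
      show "\<forall>n\<in>{n. n \<in> D \<and> p dvd n} - {n. n \<in> D \<and> p dvd n \<and> \<not> p ^ 2 dvd n}. t n = 0"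
      proof
        fix n assume "n \<in> {n. n \<in> D \<and> p dvd n} - {n. n \<in> D \<and> p dvd n \<and> \<not> p ^ 2 dvd n}"
        then have "\<not> squarefree n"
          using p by (auto simp: squarefree_def)
        then show "t n = 0" by (simp add: t_def moebius_def)
      qed
    qed (use fin in auto)
    also have "\<dots> = (\<Sum>n | (n \<in> D \<and> \<not> p dvd n) \<and> p * n \<in> D. t (p * n))"
      by (rule sum.reindex_bij_witness[where i = "\<lambda>n. p * n" and j = "\<lambda>n. n div p"])
        (use p0 dvd in \<open>auto simp: power2_eq_square\<close>)
    also have "\<dots> = (\<Sum>n | n \<in> D \<and> \<not> p dvd n. if p * n \<in> D then t (p * n) else 0)"
      using fin by (subst sum.inter_filter[symmetric]) auto
    finally have "sum t D = (\<Sum>n | n \<in> D \<and> \<not> p dvd n. t n + (if p * n \<in> D then t (p * n) else 0))"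
      by (simp add: sum.distrib)
    also have "\<dots> \<in> L_local p"
    proof (rule loc.sum_closed)
      fix n assume "n \<in> {n. n \<in> D \<and> \<not> p dvd n}"
      then have n: "mi_dvd n S" "\<not> p dvd n" by (auto simp: D_def)
      note n0 = mi_dvdD(1)[OF n(1)]
      define V where "V = (mi_size S div n, mi_div S n)"
      let ?W' = "{w\<in>words. scale_idx p (sum_list w) = V}"
      have W': "log_coeff k ?W' = (if p * n \<in> D then log_coeff k (W (p * n)) else 0)" for k
      proof (cases "p * n \<in> D")
        case True
        then have *: "mi_dvd (p * n) S" by (simp add: D_def)
        have "scale_idx p (mi_size S div (p * n), mi_div S (p * n)) = V"
        proof -
          have "p * (a div (p * n)) = a div n" if "p * n dvd a" for a
            using that p0 n0 by (auto elim!: dvdE simp: mult.assoc mult.left_commute[of p n])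
          then show ?thesis
            using * mi_dvdD(3)[OF *] by (simp add: V_def scale_idx_def vec_eq_iff mi_div_def mi_dvd_def)
        qed
        then have "?W' = W (p * n)"
          unfolding W_def using scale_idx_inject[OF p0] by metis
        then show ?thesis using True by simp
      next
        case False
        have "?W' = {}"
        proof (rule ccontr)
          assume "?W' \<noteq> {}"
          then obtain v where "scale_idx p v = V" by blast
          then have *: "mi_div S n $ i = p * snd v $ i" for i
            by (auto simp: V_def scale_idx_def vec_eq_iff)
          have "S $ i = p * n * snd v $ i" for i
            unfolding mi_dvdD(2)[OF n(1), of i, symmetric] * by simp
          then show False using False p0 n0 by (auto simp: D_def mi_dvd_def)
        qed
        then show ?thesis using False by (simp only: log_coeff_def sum.empty if_False)
      qed
      have cong: "L.cong_in p (h n v ^ p) (h (p * n) v)" if v: "fst v \<ge> 1" for v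
      proof -
        have "[:int p:] dvd \<psi> (n * p) - \<psi> n ^ p"
          using psi_cong[OF p, of n] n0 by (simp add: const_poly_dvd_iff cong_0_iff)
        then have "of_nat p dvd \<psi> n ^ p - \<psi> (p * n)"
          by (metis dvd_minus_iff minus_diff_eq mult.commute of_nat_poly)
        then show ?thesis
          using p v n0 p0 psi g_L
          by (cases v) (auto simp: h_def intro!: subst_fract_frobenius L.uminus_closed)
      qed
      have "log_coeff (h n) (W n) - log_coeff (h (p * n)) ?W' / of_nat p \<in> L_local p"
        unfolding W_def V_def[symmetric]
      proof (rule log_coeff_frobenius[OF p])
        show "fst V > 0" using pos[OF n(1)] by (simp add: V_def)
      qed (use h_L cong n0 p0 in auto)
      moreover have "of_int (moebius n) * (1 / of_nat n) \<in> L_local p"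
        using n0 prime_imp_coprime[OF p n(2)]
        by (intro loc.mult_closed loc.of_int_closed inverse_of_nat_in_L_local) (auto simp: coprime_commute)
      ultimately have "of_int (moebius n) * (1 / of_nat n) *
          (log_coeff (h n) (W n) - log_coeff (h (p * n)) ?W' / of_nat p) \<in> L_local p"
        by (rule loc.mult_closed[rotated])
      also have "of_int (moebius n) * (1 / of_nat n) *
          (log_coeff (h n) (W n) - log_coeff (h (p * n)) ?W' / of_nat p) =
          t n + (if p * n \<in> D then t (p * n) else 0)"
        using p0 n0 moebius_prime_mult[OF p n(2) n0]
        by (simp add: W' t_def field_simps mult.commute[of p n])
      finally show "t n + (if p * n \<in> D then t (p * n) else 0) \<in> L_local p" .
    qed
    finally have "X_fract * - sum t D \<in> L_local p"
      using X_fract_in_L_ring L_ring_subset_L_local by (intro loc.mult_closed loc.uminus_closed) auto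
    also have "X_fract * - sum t D = f S"
      unfolding f_eq[OF \<open>S \<noteq> 0\<close>] t_def D_def by (simp add: inner sum_negf[symmetric])
    finally show ?thesis .
  qed
  then show "f S \<in> int_polys"
    using int_polys_if_locally[OF f_rat[OF \<open>S \<noteq> 0\<close>]] by blast
qed

end
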